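(* Let $\mathcal{M}$ be a $K$-causal spacetime without boundary. Then for every $p\in\mathcal{M}$ the set $A^+(p)$ is open in the manifold topology of $\mathcal{M}$; in fact, $A^+(p)$ is the topological interior of $K^+(p)$.
   Context: A spacetime is a smooth connected Hausdorff paracompact manifold $\mathcal{M}$ (of arbitrary dimension $\ge 2$) with a smooth time-oriented Lorentzian metric. $I^+(p)$ is the set of events accessible from $p$ by future-directed timelike curves starting from $p$, and $I^+$, regarded as a relation, is $\{(p,q): q\in I^+(p)\}\subseteq\mathcal{M}\times\mathcal{M}$. The relation $K^+$, also written $\prec$, is the smallest relation on $\mathcal{M}$ that contains $I^+$, is transitive, and is topologically closed as a subset of $\mathcal{M}\times\mathcal{M}$ (i.e. the intersection of all closed transitive relations containing $I^+$). $K^+(p)=\{q\in\mathcal{M}: p\prec q\}$. The spacetime $\mathcal{M}$ is $K$-causal iff $\prec$ is a (reflexive) partial order on $\mathcal{M}$, i.e. $\prec$ is antisymmetric. The causal (order-theoretic) boundary $\partial K^+(p)$ is the set of all $x\in K^+(p)$ for which there is an increasing sequence $y_1\prec y_2\prec y_3\prec\cdots$ of points, all belonging to the complement of $K^+(p)$, such that $x=\sup\{y_i\}$, the supremum (least upper bound) being taken in $\mathcal{M}$ with respect to $\prec$. One sets $A^+(p)=K^+(p)\setminus\partial K^+(p)$. *)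

theory Defs
  imports "HOL-Analysis.Analysis"
begin

section \<open>Smooth manifolds\<close>

text \<open>
  \<open>C_k_on k S f\<close> says that \<open>f\<close> has continuous derivatives up to order \<open>k\<close> on the open set \<open>S\<close>.
  In finite dimension, differentiating in every fixed direction \<open>v\<close> captures the full derivative.
\<close>

primrec C_k_on :: "nat \<Rightarrow> 'a::real_normed_vector set \<Rightarrow> ('a \<Rightarrow> 'b::real_normed_vector) \<Rightarrow> bool" where
  "C_k_on 0 S f \<longleftrightarrow> continuous_on S f"
| "C_k_on (Suc k) S f \<longleftrightarrow>
     (\<forall>x\<in>S. f differentiable (at x)) \<and> (\<forall>v. C_k_on k S (\<lambda>x. frechet_derivative f (at x) v))"

definition smooth_on :: "'a::real_normed_vector set \<Rightarrow> ('a \<Rightarrow> 'b::real_normed_vector) \<Rightarrow> bool" where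
  "smooth_on S f \<longleftrightarrow> (\<forall>k. C_k_on k S f)"

text \<open>
  The manifold is a whole type \<open>'m\<close>, modelled on the Euclidean space \<open>'e\<close>. A chart is a pair
  \<open>(U, \<phi>)\<close>; the values of \<open>\<phi>\<close> outside its domain \<open>U\<close> are irrelevant. Chart images are open in
  the full Euclidean space, so the manifolds have no boundary.
\<close>

type_synonym ('m, 'e) chart = "'m set \<times> ('m \<Rightarrow> 'e)"

abbreviation chart_inv :: "('m, 'e) chart \<Rightarrow> 'e \<Rightarrow> 'm" where
  "chart_inv c \<equiv> inv_into (fst c) (snd c)"

definition is_chart :: "('m::topological_space, 'e::euclidean_space) chart \<Rightarrow> bool" where
  "is_chart c \<longleftrightarrow> open (fst c) \<and> open (snd c ` fst c) \<and>
     homeomorphism (fst c) (snd c ` fst c) (snd c) (chart_inv c)"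

definition transition :: "('m, 'e) chart \<Rightarrow> ('m, 'e) chart \<Rightarrow> 'e \<Rightarrow> 'e" where
  "transition c d = snd d \<circ> chart_inv c"

definition transition_deriv ::
  "('m, 'e::euclidean_space) chart \<Rightarrow> ('m, 'e) chart \<Rightarrow> 'm \<Rightarrow> 'e \<Rightarrow> 'e" where
  "transition_deriv c d p = frechet_derivative (transition c d) (at (snd c p))"

definition smooth_atlas :: "('m::topological_space, 'e::euclidean_space) chart set \<Rightarrow> bool" where
  "smooth_atlas \<A> \<longleftrightarrow> (\<forall>c\<in>\<A>. is_chart c) \<and> (\<Union>c\<in>\<A>. fst c) = UNIV \<and>
     (\<forall>c\<in>\<A>. \<forall>d\<in>\<A>. smooth_on (snd c ` (fst c \<inter> fst d)) (transition c d))"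

definition paracompact :: "'m::topological_space itself \<Rightarrow> bool" where
  "paracompact _ \<longleftrightarrow>
     (\<forall>\<U> :: 'm set set. (\<forall>U\<in>\<U>. open U) \<and> \<Union>\<U> = UNIV \<longrightarrow>
       (\<exists>\<V>. (\<forall>V\<in>\<V>. open V \<and> (\<exists>U\<in>\<U>. V \<subseteq> U)) \<and> \<Union>\<V> = UNIV \<and> locally_finite_in euclidean \<V>))"

section \<open>Time-oriented Lorentzian metrics\<close>

text \<open>
  Tensor fields are given by their coordinate expressions: a tangent vector at \<open>p\<close> has components
  in \<open>'e\<close> with respect to each chart around \<open>p\<close>, and components with respect to charts \<open>c\<close> and \<open>d\<close>
  are related by \<open>transition_deriv c d p\<close>. Thus \<open>g c p\<close> is the bilinear form at \<open>p\<close> in the chart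
  \<open>c\<close>, and \<open>T c p\<close> is the component vector at \<open>p\<close>, in the chart \<open>c\<close>, of the vector field \<open>T\<close>.
  Only the values for charts \<open>c\<close> of the atlas with \<open>p\<close> in their domain matter.
\<close>

type_synonym ('m, 'e) metric_field = "('m, 'e) chart \<Rightarrow> 'm \<Rightarrow> 'e \<Rightarrow> 'e \<Rightarrow> real"
type_synonym ('m, 'e) vector_field = "('m, 'e) chart \<Rightarrow> 'm \<Rightarrow> 'e"

text \<open>Signature \<open>(-,+,\<dots>,+)\<close>, expressed by an orthonormal basis \<open>B\<close> with timelike member \<open>e\<close>.\<close>

definition lorentzian_form :: "('e::euclidean_space \<Rightarrow> 'e \<Rightarrow> real) \<Rightarrow> bool" where
  "lorentzian_form h \<longleftrightarrow> bilinear h \<and> (\<forall>v w. h v w = h w v) \<and>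
     (\<exists>B e. independent B \<and> span B = UNIV \<and> e \<in> B \<and> h e e = -1 \<and>
        (\<forall>b\<in>B - {e}. h b b = 1) \<and> (\<forall>b\<in>B. \<forall>b'\<in>B. b \<noteq> b' \<longrightarrow> h b b' = 0))"

definition lorentzian_metric ::
  "('m::topological_space, 'e::euclidean_space) chart set \<Rightarrow> ('m, 'e) metric_field \<Rightarrow> bool" where
  "lorentzian_metric \<A> g \<longleftrightarrow>
     (\<forall>c\<in>\<A>. \<forall>p\<in>fst c. lorentzian_form (g c p)) \<and>
     (\<forall>c\<in>\<A>. \<forall>d\<in>\<A>. \<forall>p\<in>fst c \<inter> fst d. \<forall>v w.
        g c p v w = g d p (transition_deriv c d p v) (transition_deriv c d p w)) \<and>
     (\<forall>c\<in>\<A>. \<forall>v w. smooth_on (snd c ` fst c) (\<lambda>x. g c (chart_inv c x) v w))"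

text \<open>A time orientation is represented by a continuous, everywhere timelike vector field.\<close>

definition time_orientation ::
  "('m::topological_space, 'e::euclidean_space) chart set \<Rightarrow> ('m, 'e) metric_field \<Rightarrow>
   ('m, 'e) vector_field \<Rightarrow> bool" where
  "time_orientation \<A> g T \<longleftrightarrow>
     (\<forall>c\<in>\<A>. continuous_on (fst c) (T c)) \<and>
     (\<forall>c\<in>\<A>. \<forall>d\<in>\<A>. \<forall>p\<in>fst c \<inter> fst d. T d p = transition_deriv c d p (T c p)) \<and>
     (\<forall>c\<in>\<A>. \<forall>p\<in>fst c. g c p (T c p) (T c p) < 0)"

text \<open>The Hausdorff property is the sort constraint \<open>t2_space\<close> on \<open>'m\<close>.\<close>

definition spacetime ::
  "('m::t2_space, 'e::euclidean_space) chart set \<Rightarrow> ('m, 'e) metric_field \<Rightarrow>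
   ('m, 'e) vector_field \<Rightarrow> bool" where
  "spacetime \<A> g T \<longleftrightarrow> DIM('e) \<ge> 2 \<and> connected (UNIV :: 'm set) \<and> paracompact TYPE('m) \<and>
     smooth_atlas \<A> \<and> lorentzian_metric \<A> g \<and> time_orientation \<A> g T"

section \<open>Chronology and the relation \<open>K\<^sup>+\<close>\<close>

definition future_timelike ::
  "('m, 'e) metric_field \<Rightarrow> ('m, 'e) vector_field \<Rightarrow> ('m, 'e) chart \<Rightarrow> 'm \<Rightarrow> 'e \<Rightarrow> bool" where
  "future_timelike g T c p v \<longleftrightarrow> g c p v v < 0 \<and> g c p v (T c p) < 0"

text \<open>
  A \<open>C\<^sup>1\<close> curve on \<open>[a,b]\<close> with future timelike velocity, one-sided at the end points.
  Continuity of \<open>\<gamma>\<close> has to be required separately, because \<open>snd c \<circ> \<gamma>\<close> is only meaningful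
  where \<open>\<gamma>\<close> runs inside the domain of the chart \<open>c\<close>.
\<close>

definition timelike_C1_on ::
  "('m::topological_space, 'e::euclidean_space) chart set \<Rightarrow> ('m, 'e) metric_field \<Rightarrow>
   ('m, 'e) vector_field \<Rightarrow> real \<Rightarrow> real \<Rightarrow> (real \<Rightarrow> 'm) \<Rightarrow> bool" where
  "timelike_C1_on \<A> g T a b \<gamma> \<longleftrightarrow> continuous_on {a..b} \<gamma> \<and>
     (\<forall>c\<in>\<A>. \<exists>v. continuous_on {t\<in>{a..b}. \<gamma> t \<in> fst c} v \<and>
        (\<forall>t\<in>{a..b}. \<gamma> t \<in> fst c \<longrightarrow>
           ((snd c \<circ> \<gamma>) has_vector_derivative v t) (at t within {a..b}) \<and>
           future_timelike g T c (\<gamma> t) (v t)))"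

definition timelike_curve ::
  "('m::topological_space, 'e::euclidean_space) chart set \<Rightarrow> ('m, 'e) metric_field \<Rightarrow>
   ('m, 'e) vector_field \<Rightarrow> (real \<Rightarrow> 'm) \<Rightarrow> bool" where
  "timelike_curve \<A> g T \<gamma> \<longleftrightarrow>
     (\<exists>n. \<exists>s :: nat \<Rightarrow> real. s 0 = 0 \<and> s n = 1 \<and>
        (\<forall>i<n. s i < s (Suc i) \<and> timelike_C1_on \<A> g T (s i) (s (Suc i)) \<gamma>))"

definition I_rel ::
  "('m::topological_space, 'e::euclidean_space) chart set \<Rightarrow> ('m, 'e) metric_field \<Rightarrow>
   ('m, 'e) vector_field \<Rightarrow> ('m \<times> 'm) set" where
  "I_rel \<A> g T = {(p, q). \<exists>\<gamma>. timelike_curve \<A> g T \<gamma> \<and> pathstart \<gamma> = p \<and> pathfinish \<gamma> = q}"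

definition K_rel ::
  "('m::topological_space, 'e::euclidean_space) chart set \<Rightarrow> ('m, 'e) metric_field \<Rightarrow>
   ('m, 'e) vector_field \<Rightarrow> ('m \<times> 'm) set" where
  "K_rel \<A> g T = \<Inter>{R. I_rel \<A> g T \<subseteq> R \<and> trans R \<and> closed R}"

text \<open>
  Transitivity of \<open>K_rel\<close> holds by construction, and reflexivity holds in every spacetime, so
  antisymmetry is all that is needed for a reflexive partial order.
\<close>

definition K_causal ::
  "('m::topological_space, 'e::euclidean_space) chart set \<Rightarrow> ('m, 'e) metric_field \<Rightarrow>
   ('m, 'e) vector_field \<Rightarrow> bool" where
  "K_causal \<A> g T \<longleftrightarrow> antisym (K_rel \<A> g T)"

definition K_plus ::
  "('m::topological_space, 'e::euclidean_space) chart set \<Rightarrow> ('m, 'e) metric_field \<Rightarrow>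
   ('m, 'e) vector_field \<Rightarrow> 'm \<Rightarrow> 'm set" where
  "K_plus \<A> g T p = {q. (p, q) \<in> K_rel \<A> g T}"

section \<open>The causal boundary\<close>

definition is_sup :: "('a \<times> 'a) set \<Rightarrow> 'a set \<Rightarrow> 'a \<Rightarrow> bool" where
  "is_sup R S x \<longleftrightarrow> (\<forall>y\<in>S. (y, x) \<in> R) \<and> (\<forall>z. (\<forall>y\<in>S. (y, z) \<in> R) \<longrightarrow> (x, z) \<in> R)"

definition causal_boundary ::
  "('m::topological_space, 'e::euclidean_space) chart set \<Rightarrow> ('m, 'e) metric_field \<Rightarrow>
   ('m, 'e) vector_field \<Rightarrow> 'm \<Rightarrow> 'm set" where
  "causal_boundary \<A> g T p = {x \<in> K_plus \<A> g T p.
     \<exists>y :: nat \<Rightarrow> 'm. (\<forall>i. (y i, y (Suc i)) \<in> K_rel \<A> g T) \<and>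
       (\<forall>i. y i \<notin> K_plus \<A> g T p) \<and> is_sup (K_rel \<A> g T) (range y) x}"

definition A_plus ::
  "('m::topological_space, 'e::euclidean_space) chart set \<Rightarrow> ('m, 'e) metric_field \<Rightarrow>
   ('m, 'e) vector_field \<Rightarrow> 'm \<Rightarrow> 'm set" where
  "A_plus \<A> g T p = K_plus \<A> g T p - causal_boundary \<A> g T p"

end

theory Submission
  imports Defs
begin

text \<open>
  If a point of \<open>K\<^sup>+(p)\<close> is not interior, approach it along a timelike segment \<open>y\<^sub>1 \<prec> y\<^sub>2 \<prec> \<dots>\<close>
  ending there; its supremum is its limit because \<open>\<prec>\<close> is closed, and no \<open>y\<^sub>i\<close> lies in
  \<open>K\<^sup>+(p)\<close> because the future \<open>I\<^sup>+(y\<^sub>i)\<close> is a neighbourhood of the point. Conversely, let \<open>x\<close>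
  be interior and the supremum of an increasing sequence \<open>y\<^sub>i\<close> outside \<open>K\<^sup>+(p)\<close>. For a small
  neighbourhood \<open>N\<close> of \<open>x\<close> with compact frontier, every \<open>y\<^sub>i \<prec> x\<close> factors as
  \<open>y\<^sub>i \<prec> z\<^sub>i \<prec> x\<close> with \<open>z\<^sub>i\<close> in the frontier, by minimality of \<open>\<prec>\<close>. An accumulation point \<open>z\<close>
  of the \<open>z\<^sub>i\<close> is an upper bound of the sequence with \<open>z \<prec> x\<close>, so antisymmetry forces \<open>z = x\<close>.
\<close>

section \<open>Closed transitive relations\<close>

text \<open>A composition of closed relations need not be closed, since the intermediate points may
  escape to infinity; confining them to a compact set prevents this. The complement is open by the
  tube lemma.\<close>

lemma closed_relcomp_compact:
  fixes K :: "('a::topological_space \<times> 'a) set"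
  assumes K: "closed K" and C: "compact C"
  shows "closed {(a, b). \<exists>z\<in>C. (a, z) \<in> K \<and> (z, b) \<in> K}" (is "closed ?Z")
proof -
  \<comment> \<open>\<open>W\<close> is the open set of all \<open>((a, b), z)\<close> for which
    \<open>z\<close> fails as an intermediate point. A pair lies outside the relation iff its whole
    slice over \<open>C\<close> lies in \<open>W\<close>.\<close>
  define W where
    "W = (\<lambda>q. (fst (fst q), snd q)) -` (- K) \<union> (\<lambda>q. (snd q, snd (fst q))) -` (- K)"
  have "open W"
    unfolding W_def by (intro open_Un open_vimage continuous_intros) (use K in auto)
  then have tube: "\<exists>X. u \<in> X \<and> open X \<and> X \<times> C \<subseteq> W" if "{u} \<times> C \<subseteq> W" for u
    using Elementary_Topology.tube_lemma[OF C _ that] by blast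
  have out: "u \<in> - ?Z \<longleftrightarrow> {u} \<times> C \<subseteq> W" for u
    by (cases u) (auto simp: W_def)
  have "\<exists>X. open X \<and> u \<in> X \<and> X \<subseteq> - ?Z" if u: "u \<in> - ?Z" for u
  proof -
    from u out obtain X where X: "u \<in> X" "open X" "X \<times> C \<subseteq> W"
      using tube by meson
    have "X \<subseteq> - ?Z"
    proof
      fix q assume "q \<in> X"
      with X(3) have "{q} \<times> C \<subseteq> W" by blast
      with out show "q \<in> - ?Z" by blast
    qed
    with X show ?thesis by blast
  qed
  then have "open (- ?Z)"
    unfolding open_subopen[of "- ?Z"] by (rule ballI)
  then show ?thesis
    by (simp only: closed_def)
qed

lemma K_rel_least: "K_rel \<A> g T \<subseteq> R" if "I_rel \<A> g T \<subseteq> R" "trans R" "closed R"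
  using that by (auto simp: K_rel_def)

lemma I_rel_subset_K_rel: "I_rel \<A> g T \<subseteq> K_rel \<A> g T"
  by (auto simp: K_rel_def)

lemma trans_K_rel: "trans (K_rel \<A> g T)"
  by (rule transI) (unfold K_rel_def, blast dest: transD)

lemma closed_K_rel: "closed (K_rel \<A> g T)"
  unfolding K_rel_def by (rule closed_Inter) auto

lemma closed_K_rel_sections:
  "closed {z. (a, z) \<in> K_rel \<A> g T}" "closed {z. (z, b) \<in> K_rel \<A> g T}"
proof -
  have "closed ((\<lambda>z. (a, z)) -` K_rel \<A> g T)" "closed ((\<lambda>z. (z, b)) -` K_rel \<A> g T)"
    by (intro closed_vimage closed_K_rel continuous_intros)+
  then show "closed {z. (a, z) \<in> K_rel \<A> g T}" "closed {z. (z, b) \<in> K_rel \<A> g T}"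
    by (simp_all add: vimage_def)
qed

section \<open>Timelike curves\<close>

text \<open>The parameter interval is arbitrary, so that a segment can be cut at an inner point
  without reparametrising. These single \<open>C^1\<close> pieces generate \<open>I_rel\<close>
  under transitive closure.\<close>

definition C1_rel ::
  "('m::topological_space, 'e::euclidean_space) chart set \<Rightarrow> ('m, 'e) metric_field \<Rightarrow>
   ('m, 'e) vector_field \<Rightarrow> ('m \<times> 'm) set" where
  "C1_rel \<A> g T = {(\<gamma> a, \<gamma> b) | \<gamma> a b. a < b \<and> timelike_C1_on \<A> g T a b \<gamma>}"

lemma I_rel_subset_trancl_C1_rel: "I_rel \<A> g T \<subseteq> (C1_rel \<A> g T)\<^sup>+"
proof clarify
  fix p q assume "(p, q) \<in> I_rel \<A> g T"
  then obtain \<gamma> n s where s: "s 0 = (0::real)" "s n = 1"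
    and C1: "\<And>i. i < n \<Longrightarrow> s i < s (Suc i) \<and> timelike_C1_on \<A> g T (s i) (s (Suc i)) \<gamma>"
    and pq: "p = \<gamma> 0" "q = \<gamma> 1"
    by (auto simp: I_rel_def timelike_curve_def pathstart_def pathfinish_def)
  have step: "(\<gamma> (s i), \<gamma> (s (Suc i))) \<in> C1_rel \<A> g T" if "i < n" for i
    using C1[OF that] by (auto simp: C1_rel_def)
  have "i < n \<Longrightarrow> (\<gamma> (s 0), \<gamma> (s (Suc i))) \<in> (C1_rel \<A> g T)\<^sup>+" for i
  proof (induction i)
    case 0
    then show ?case using step by blast
  next
    case (Suc i)
    then show ?case using step[of "Suc i"] by (meson Suc_lessD trancl.trancl_into_trancl)
  qed
  \<comment> \<open>\<open>s 0\<close> and \<open>s n\<close> differ, so there is at least one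
    piece; hence the transitive closure suffices, without reflexivity.\<close>
  moreover obtain m where "n = Suc m" using s by (cases n) auto
  ultimately show "(p, q) \<in> (C1_rel \<A> g T)\<^sup>+"
    using s pq by (metis lessI)
qed

lemma timelike_C1_on_continuous: "timelike_C1_on \<A> g T a b \<gamma> \<Longrightarrow> continuous_on {a..b} \<gamma>"
  by (simp add: timelike_C1_on_def)

lemma timelike_C1_on_subinterval:
  assumes "timelike_C1_on \<A> g T a b \<gamma>" "{c..d} \<subseteq> {a..b}"
  shows "timelike_C1_on \<A> g T c d \<gamma>"
  unfolding timelike_C1_on_def
proof (intro conjI ballI)
  show "continuous_on {c..d} \<gamma>"
    by (rule continuous_on_subset[OF timelike_C1_on_continuous]) (rule assms)+
  fix h assume "h \<in> \<A>"
  with assms obtain v where v: "continuous_on {t\<in>{a..b}. \<gamma> t \<in> fst h} v"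
    "\<And>t. t \<in> {a..b} \<Longrightarrow> \<gamma> t \<in> fst h \<Longrightarrow>
       ((snd h \<circ> \<gamma>) has_vector_derivative v t) (at t within {a..b}) \<and>
       future_timelike g T h (\<gamma> t) (v t)"
    unfolding timelike_C1_on_def by meson
  show "\<exists>v. continuous_on {t\<in>{c..d}. \<gamma> t \<in> fst h} v \<and>
        (\<forall>t\<in>{c..d}. \<gamma> t \<in> fst h \<longrightarrow>
           ((snd h \<circ> \<gamma>) has_vector_derivative v t) (at t within {c..d}) \<and>
           future_timelike g T h (\<gamma> t) (v t))"
  proof (intro exI[of _ v] conjI ballI impI)
    show "continuous_on {t\<in>{c..d}. \<gamma> t \<in> fst h} v"
      by (rule continuous_on_subset[OF v(1)]) (use assms(2) in auto)
    fix t assume t: "t \<in> {c..d}" "\<gamma> t \<in> fst h"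
    with assms(2) have "t \<in> {a..b}" by blast
    with v(2) t assms(2) show "((snd h \<circ> \<gamma>) has_vector_derivative v t) (at t within {c..d})"
      "future_timelike g T h (\<gamma> t) (v t)"
      by (blast intro: has_vector_derivative_within_subset)+
  qed
qed

section \<open>Affine reparametrisation of timelike segments\<close>

locale spacetime_context =
  fixes \<A> :: "('m::t2_space, 'e::euclidean_space) chart set"
    and g :: "('m, 'e) metric_field"
    and T :: "('m, 'e) vector_field"
  assumes spacetime: "spacetime \<A> g T"
begin

lemma bilinear_metric: "c \<in> \<A> \<Longrightarrow> p \<in> fst c \<Longrightarrow> bilinear (g c p)"
  using spacetime by (simp add: spacetime_def lorentzian_metric_def lorentzian_form_def)

lemma future_timelike_scaleR:
  assumes "c \<in> \<A>" "p \<in> fst c" "future_timelike g T c p v" "k > 0"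
  shows "future_timelike g T c p (k *\<^sub>R v)"
  using assms bilinear_metric[OF assms(1,2)]
  by (simp add: future_timelike_def bilinear_lmul bilinear_rmul mult_pos_neg)

text \<open>The affine map \<open>l\<close> from \<open>{0..1}\<close> onto \<open>{a..b}\<close>
  multiplies the velocity by \<open>b - a > 0\<close>, and positive multiples of future timelike
  vectors are future timelike.\<close>

lemma C1_rel_subset_I_rel: "C1_rel \<A> g T \<subseteq> I_rel \<A> g T"
proof
  fix u assume "u \<in> C1_rel \<A> g T"
  then obtain \<gamma> a b where u: "u = (\<gamma> a, \<gamma> b)" and ab: "a < b"
    and \<gamma>: "timelike_C1_on \<A> g T a b \<gamma>"
    by (auto simp: C1_rel_def)
  define l where "l = (\<lambda>t. a + t * (b - a))"
  have l: "l ` {0..1} \<subseteq> {a..b}"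
  proof clarify
    fix t :: real assume "t \<in> {0..1}"
    then have "0 \<le> t * (b - a)" "t * (b - a) \<le> 1 * (b - a)"
      using ab by (auto intro: mult_right_mono simp del: mult_1)
    then show "l t \<in> {a..b}" by (simp add: l_def)
  qed
  have cont_l: "continuous_on S l" for S
    unfolding l_def by (intro continuous_intros)
  have dl: "(l has_vector_derivative (b - a)) (at t within S)" for t S
    unfolding l_def has_real_derivative_iff_has_vector_derivative[symmetric]
    by (auto intro!: derivative_eq_intros)
  have "timelike_C1_on \<A> g T 0 1 (\<gamma> \<circ> l)"
    unfolding timelike_C1_on_def
  proof (intro conjI ballI)
    show "continuous_on {0..1} (\<gamma> \<circ> l)"
      by (intro continuous_on_compose cont_l
          continuous_on_subset[OF timelike_C1_on_continuous[OF \<gamma>] l])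
    fix h assume h: "h \<in> \<A>"
    with \<gamma> obtain v where v: "continuous_on {t\<in>{a..b}. \<gamma> t \<in> fst h} v"
      "\<And>t. t \<in> {a..b} \<Longrightarrow> \<gamma> t \<in> fst h \<Longrightarrow>
         ((snd h \<circ> \<gamma>) has_vector_derivative v t) (at t within {a..b}) \<and>
         future_timelike g T h (\<gamma> t) (v t)"
      unfolding timelike_C1_on_def by meson
    show "\<exists>v. continuous_on {t\<in>{0..1}. (\<gamma> \<circ> l) t \<in> fst h} v \<and>
        (\<forall>t\<in>{0..1}. (\<gamma> \<circ> l) t \<in> fst h \<longrightarrow>
           ((snd h \<circ> (\<gamma> \<circ> l)) has_vector_derivative v t) (at t within {0..1}) \<and>
           future_timelike g T h ((\<gamma> \<circ> l) t) (v t))"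
    proof (intro exI[of _ "\<lambda>t. (b - a) *\<^sub>R v (l t)"] conjI ballI impI)
      have "continuous_on {t\<in>{0..1}. (\<gamma> \<circ> l) t \<in> fst h} (v \<circ> l)"
        using l by (intro continuous_on_compose cont_l continuous_on_subset[OF v(1)])
          (auto simp: image_subset_iff)
      then show "continuous_on {t\<in>{0..1}. (\<gamma> \<circ> l) t \<in> fst h} (\<lambda>t. (b - a) *\<^sub>R v (l t))"
        by (auto simp: o_def intro: continuous_intros)
      fix t :: real assume t: "t \<in> {0..1}" "(\<gamma> \<circ> l) t \<in> fst h"
      with l have lt: "l t \<in> {a..b}" "\<gamma> (l t) \<in> fst h" by (auto simp del: atLeastAtMost_iff)
      have "((snd h \<circ> \<gamma>) has_vector_derivative v (l t)) (at (l t) within l ` {0..1})"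
        using v(2)[OF lt] l by (blast intro: has_vector_derivative_within_subset)
      from vector_diff_chain_within[OF dl this]
      show "((snd h \<circ> (\<gamma> \<circ> l)) has_vector_derivative (b - a) *\<^sub>R v (l t)) (at t within {0..1})"
        by (simp only: o_assoc)
      show "future_timelike g T h ((\<gamma> \<circ> l) t) ((b - a) *\<^sub>R v (l t))"
        using future_timelike_scaleR[OF h lt(2)] v(2)[OF lt] ab by simp
    qed
  qed
  \<comment> \<open>A partition with one piece; its break points \<open>0\<close> and
    \<open>1\<close> are values of \<open>real\<close>.\<close>
  then have "timelike_curve \<A> g T (\<gamma> \<circ> l)"
    unfolding timelike_curve_def by (intro exI[of _ 1] exI[of _ real]) auto
  then show "u \<in> I_rel \<A> g T"
    unfolding I_rel_def u by (auto intro!: exI[of _ "\<gamma> \<circ> l"] simp: pathstart_def pathfinish_def l_def)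
qed

text \<open>
  The relation \<open>R\<close> below is closed, transitive and contains every \<open>C\<^sup>1\<close> timelike segment, so it
  contains \<open>K\<^sup>+\<close> by minimality. Allowing pairs in \<open>closure N \<times> closure N\<close> and in
  \<open>(- N) \<times> (- N)\<close> makes it closed; these two sets overlap only over the frontier.
\<close>

lemma K_rel_crosses_frontier:
  assumes N: "open N" "compact (frontier N)"
    and yx: "(y, x) \<in> K_rel \<A> g T" and "y \<notin> closure N" "x \<in> N"
  shows "\<exists>z\<in>frontier N. (y, z) \<in> K_rel \<A> g T \<and> (z, x) \<in> K_rel \<A> g T"
proof -
  define K where "K = K_rel \<A> g T"
  define Z where "Z = {(a, b). \<exists>z\<in>frontier N. (a, z) \<in> K \<and> (z, b) \<in> K}"
  define R where "R = K \<inter> (Z \<union> closure N \<times> closure N \<union> (- N) \<times> (- N))"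
  have fr: "frontier N = closure N - N"
    using N(1) by (simp add: frontier_def interior_open)
  have trK: "(a, c) \<in> K" if "(a, b) \<in> K" "(b, c) \<in> K" for a b c
    using trans_K_rel that unfolding K_def by (rule transD)
  have C1K: "C1_rel \<A> g T \<subseteq> K"
    using C1_rel_subset_I_rel I_rel_subset_K_rel unfolding K_def by blast
  have "closed Z"
    unfolding Z_def K_def by (rule closed_relcomp_compact[OF closed_K_rel N(2)])
  then have "closed R"
    unfolding R_def K_def using N(1)
    by (intro closed_Int closed_Un closed_Times closed_K_rel) auto
  moreover have "trans R"
  proof (rule transI)
    fix a b c assume ab: "(a, b) \<in> R" and bc: "(b, c) \<in> R"
    then have K: "(a, b) \<in> K" "(b, c) \<in> K" by (auto simp: R_def)
    \<comment> \<open>If neither pair is in \<open>Z\<close>, each lies in one of the two squares.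
      Squares of different kinds force the shared point \<open>b\<close> into
      \<open>closure N - N\<close>, the frontier, and \<open>b\<close> itself is then the
      intermediate point. Squares of the same kind compose.\<close>
    consider "(a, b) \<in> Z" | "(b, c) \<in> Z" | "b \<in> frontier N"
      | "a \<in> closure N" "c \<in> closure N" | "a \<notin> N" "c \<notin> N"
      using ab bc unfolding R_def fr by blast
    then have "(a, c) \<in> Z \<union> closure N \<times> closure N \<union> (- N) \<times> (- N)"
    proof cases
      case 1
      then show ?thesis using trK K(2) unfolding Z_def by blast
    next
      case 2
      then show ?thesis using trK K(1) unfolding Z_def by blast
    next
      case 3
      then show ?thesis using K unfolding Z_def by blast
    qed auto
    moreover have "(a, c) \<in> K" using trK K .
    ultimately show "(a, c) \<in> R" by (simp add: R_def)
  qed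
  moreover have "C1_rel \<A> g T \<subseteq> R"
  proof
    fix u assume u: "u \<in> C1_rel \<A> g T"
    then obtain \<gamma> a b where ab: "u = (\<gamma> a, \<gamma> b)" "a < b"
      and \<gamma>: "timelike_C1_on \<A> g T a b \<gamma>"
      by (auto simp: C1_rel_def)
    \<comment> \<open>A segment in neither square has one end in \<open>N\<close> and the other
      outside \<open>closure N\<close>, so by connectedness it meets the frontier.\<close>
    have "u \<in> Z" if not: "u \<notin> closure N \<times> closure N" "u \<notin> (- N) \<times> (- N)"
    proof -
      have "connected (\<gamma> ` {a..b})"
        by (intro connected_continuous_image timelike_C1_on_continuous[OF \<gamma>]) simp
      moreover have "\<gamma> a \<in> \<gamma> ` {a..b}" "\<gamma> b \<in> \<gamma> ` {a..b}"
        using ab by auto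
      moreover have ends: "\<gamma> a \<in> N \<and> \<gamma> b \<notin> closure N \<or> \<gamma> b \<in> N \<and> \<gamma> a \<notin> closure N"
        using not ab(1) closure_subset[of N] by auto
      ultimately have "\<gamma> ` {a..b} \<inter> frontier N \<noteq> {}"
        using closure_subset[of N] by (intro connected_Int_frontier) blast+
      then obtain t where t: "t \<in> {a..b}" "\<gamma> t \<in> frontier N" by blast
      \<comment> \<open>Neither end is on the frontier, so both parts of the segment cut at
        \<open>t\<close> are nondegenerate.\<close>
      with ends fr have "a < t" "t < b" by (auto simp: less_le)
      then have "(\<gamma> a, \<gamma> t) \<in> C1_rel \<A> g T" "(\<gamma> t, \<gamma> b) \<in> C1_rel \<A> g T"
        using timelike_C1_on_subinterval[OF \<gamma>, of a t] timelike_C1_on_subinterval[OF \<gamma>, of t b]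
        unfolding C1_rel_def by fastforce+
      with t C1K ab show ?thesis by (auto simp: Z_def)
    qed
    with u C1K show "u \<in> R" by (auto simp: R_def)
  qed
  ultimately have "K \<subseteq> R"
    unfolding K_def
    using I_rel_subset_trancl_C1_rel[of \<A> g T] trancl_mono_subset[of "C1_rel \<A> g T" R]
      trancl_id[of R]
    by (intro K_rel_least) auto
  \<comment> \<open>\<open>y\<close> is outside \<open>closure N\<close> and \<open>x\<close> is in
    \<open>N\<close>, which rules out both squares and leaves only \<open>Z\<close>.\<close>
  with assms have "(y, x) \<in> Z"
    unfolding K_def[symmetric] by (auto simp: R_def)
  then show ?thesis by (simp add: Z_def K_def)
qed

section \<open>Local structure\<close>

lemma chart_exists: obtains c where "c \<in> \<A>" "p \<in> fst c"
proof -
  have "p \<in> (\<Union>c\<in>\<A>. fst c)"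
    using spacetime by (simp add: spacetime_def smooth_atlas_def)
  then show thesis using that by blast
qed

lemma chart:
  assumes "c \<in> \<A>"
  shows "open (fst c)" "open (snd c ` fst c)"
    "homeomorphism (fst c) (snd c ` fst c) (snd c) (chart_inv c)"
  using spacetime assms by (auto simp: spacetime_def smooth_atlas_def is_chart_def)

lemma chart_inv_simps:
  assumes "c \<in> \<A>"
  shows "p \<in> fst c \<Longrightarrow> chart_inv c (snd c p) = p"
    "z \<in> snd c ` fst c \<Longrightarrow> chart_inv c z \<in> fst c"
    "z \<in> snd c ` fst c \<Longrightarrow> snd c (chart_inv c z) = z"
  using chart(3)[OF assms] by (auto simp: homeomorphism_def)

lemma continuous_on_chart_inv: "c \<in> \<A> \<Longrightarrow> continuous_on (snd c ` fst c) (chart_inv c)"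
  using chart(3) by (auto simp: homeomorphism_def)

lemma open_chart_image:
  assumes "c \<in> \<A>" "open W" "W \<subseteq> fst c"
  shows "open (snd c ` W)"
  using homeomorphism_imp_open_map[OF chart(3)[OF assms(1)], of W] assms chart[OF assms(1)]
  by (simp add: openin_open_eq)

lemma open_chart_inv_image:
  assumes "c \<in> \<A>" "open W" "W \<subseteq> snd c ` fst c"
  shows "open (chart_inv c ` W)"
  using homeomorphism_imp_open_map[OF homeomorphism_symD[OF chart(3)[OF assms(1)]], of W]
    assms chart[OF assms(1)]
  by (simp add: openin_open_eq)

text \<open>Local compactness comes from the model space: \<open>N\<close> and \<open>C\<close>
  correspond to an open and a closed ball in a chart. The compact set \<open>C\<close> is closed
  because the manifold is Hausdorff, so it contains \<open>closure N\<close>.\<close>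

lemma precompact_neighbourhood:
  fixes W :: "'m set"
  assumes "open W" "x \<in> W"
  obtains N where "open N" "x \<in> N" "compact (closure N)" "closure N \<subseteq> W"
proof -
  obtain c where c: "c \<in> \<A>" "x \<in> fst c" by (rule chart_exists)
  have "open (snd c ` (fst c \<inter> W))"
    using c chart(1) assms by (intro open_chart_image open_Int) auto
  then obtain r where r: "r > 0" "cball (snd c x) r \<subseteq> snd c ` (fst c \<inter> W)"
    using assms c by (metis IntI image_eqI open_contains_cball)
  define N where "N = chart_inv c ` ball (snd c x) r"
  define C where "C = chart_inv c ` cball (snd c x) r"
  have sub: "cball (snd c x) r \<subseteq> snd c ` fst c" using r by blast
  have "compact C"
    unfolding C_def using sub continuous_on_chart_inv[OF c(1)]
    by (intro compact_continuous_image) (auto intro: continuous_on_subset)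
  moreover have "N \<subseteq> C" unfolding N_def C_def by (rule image_mono) auto
  ultimately have N: "closure N \<subseteq> C"
    by (simp add: closure_minimal compact_imp_closed)
  have "C \<subseteq> W"
    unfolding C_def using r(2) chart_inv_simps(1)[OF c(1)] by fastforce
  moreover have "open N"
    unfolding N_def using sub by (intro open_chart_inv_image c) (auto simp: subset_iff)
  moreover have "x \<in> N"
    unfolding N_def using chart_inv_simps(1)[OF c] r(1) by (metis centre_in_ball image_eqI)
  moreover have "compact (closure N)"
    using compact_Int_closed[OF \<open>compact C\<close> closed_closure[of N]] N by (simp add: Int_absorb1)
  ultimately show thesis using that N by blast
qed

section \<open>Openness of the future timelike condition\<close>

lemma continuous_on_metric:
  assumes "c \<in> \<A>"
  shows "continuous_on (snd c ` fst c) (\<lambda>z. g c (chart_inv c z) v w)"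
proof -
  have "smooth_on (snd c ` fst c) (\<lambda>z. g c (chart_inv c z) v w)"
    using spacetime assms unfolding spacetime_def lorentzian_metric_def by blast
  then have "C_k_on 0 (snd c ` fst c) (\<lambda>z. g c (chart_inv c z) v w)"
    unfolding smooth_on_def by blast
  then show ?thesis by simp
qed

text \<open>Smoothness of \<open>g\<close> is given for fixed vector arguments only. Finitely many
  components with basis vectors turn this into joint continuity in the point and the
  vectors.\<close>

lemma metric_expansion:
  assumes "c \<in> \<A>" "p \<in> fst c"
  shows "g c p v w = (\<Sum>(i, j)\<in>Basis \<times> Basis. (v \<bullet> i) * (w \<bullet> j) * g c p i j)"
proof -
  note b = bilinear_metric[OF assms]
  have "g c p v w = g c p (\<Sum>i\<in>Basis. (v \<bullet> i) *\<^sub>R i) (\<Sum>j\<in>Basis. (w \<bullet> j) *\<^sub>R j)"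
    by (simp add: euclidean_representation)
  also have "\<dots> = (\<Sum>(i, j)\<in>Basis \<times> Basis. g c p ((v \<bullet> i) *\<^sub>R i) ((w \<bullet> j) *\<^sub>R j))"
    by (rule bilinear_sum[OF b])
  finally show ?thesis
    by (simp add: bilinear_lmul[OF b] bilinear_rmul[OF b] mult_ac)
qed

text \<open>Being future timelike means two strict inequalities, \<open>F < 0\<close> and
  \<open>G < 0\<close>, between functions continuous in point and vector together. They therefore
  persist on a box around any solution.\<close>

lemma future_timelike_neighbourhood:
  assumes c: "c \<in> \<A>" "x \<in> fst c"
  obtains r \<delta> where "r > 0" "\<delta> > 0" "ball (snd c x) r \<subseteq> snd c ` fst c"
    "\<And>z w. z \<in> ball (snd c x) r \<Longrightarrow> w \<in> ball (T c x) \<delta> \<Longrightarrow>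
       future_timelike g T c (chart_inv c z) w"
proof -
  define V where "V = snd c ` fst c"
  define F where "F = (\<lambda>(z, w). g c (chart_inv c z) w w)"
  define G where "G = (\<lambda>(z, w). g c (chart_inv c z) w (T c (chart_inv c z)))"
  have oV: "open (V \<times> (UNIV :: 'e set))"
    unfolding V_def by (intro open_Times chart c open_UNIV)
  have T: "continuous_on V (\<lambda>z. T c (chart_inv c z))"
  proof (rule continuous_on_compose2[where g = "T c"])
    show "continuous_on (fst c) (T c)"
      using spacetime c unfolding spacetime_def time_orientation_def by blast
    show "continuous_on V (chart_inv c)"
      unfolding V_def by (rule continuous_on_chart_inv[OF c(1)])
    show "chart_inv c ` V \<subseteq> fst c"
      unfolding V_def using chart_inv_simps(2)[OF c(1)] by (rule image_subsetI)
  qed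
  have cm: "continuous_on (V \<times> UNIV) (\<lambda>q. g c (chart_inv c (fst q)) v w)" for v w
    by (rule continuous_on_compose2[OF continuous_on_metric[OF c(1)]
          continuous_on_fst[OF continuous_on_id]]) (simp add: V_def)
  have cT: "continuous_on (V \<times> UNIV) (\<lambda>q. T c (chart_inv c (fst q)))"
    by (rule continuous_on_compose2[OF T continuous_on_fst[OF continuous_on_id]]) simp
  have "continuous_on (V \<times> UNIV) F"
  proof (rule continuous_on_eq)
    show "continuous_on (V \<times> UNIV) (\<lambda>q. \<Sum>k\<in>Basis \<times> Basis.
        (snd q \<bullet> fst k) * (snd q \<bullet> snd k) * g c (chart_inv c (fst q)) (fst k) (snd k))"
      by (intro continuous_intros cm)
  qed (auto simp: F_def V_def split_def metric_expansion[OF c(1) chart_inv_simps(2)[OF c(1)],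
        of _ w w for w])
  moreover have "continuous_on (V \<times> UNIV) G"
  proof (rule continuous_on_eq)
    show "continuous_on (V \<times> UNIV) (\<lambda>q. \<Sum>k\<in>Basis \<times> Basis.
        (snd q \<bullet> fst k) * (T c (chart_inv c (fst q)) \<bullet> snd k) *
        g c (chart_inv c (fst q)) (fst k) (snd k))"
      by (intro continuous_intros cm cT)
  qed (auto simp: G_def V_def split_def metric_expansion[OF c(1) chart_inv_simps(2)[OF c(1)],
        of _ w "T c p" for w p])
  ultimately have "open ((V \<times> UNIV) \<inter> F -` {..<0})" "open ((V \<times> UNIV) \<inter> G -` {..<0})"
    using oV by (auto intro: continuous_open_preimage)
  then have "open ((V \<times> UNIV) \<inter> F -` {..<0} \<inter> ((V \<times> UNIV) \<inter> G -` {..<0}))" (is "open ?S")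
    by (rule open_Int)
  \<comment> \<open>For the vector \<open>T c x\<close> at \<open>x\<close> both inequalities reduce
    to \<open>T\<close> being timelike.\<close>
  moreover have "g c x (T c x) (T c x) < 0"
    using c spacetime unfolding spacetime_def time_orientation_def by blast
  then have "(snd c x, T c x) \<in> ?S"
    using c(2) chart_inv_simps(1)[OF c] by (simp add: F_def G_def V_def)
  ultimately obtain A B where AB: "open A" "open B" "snd c x \<in> A" "T c x \<in> B" "A \<times> B \<subseteq> ?S"
    by (rule open_prod_elim) auto
  then obtain r \<delta> where r: "r > 0" "ball (snd c x) r \<subseteq> A" "\<delta> > 0" "ball (T c x) \<delta> \<subseteq> B"
    by (meson openE)
  show thesis
  proof (rule that[OF r(1,3)])
    show "ball (snd c x) r \<subseteq> snd c ` fst c"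
      using AB r unfolding V_def by blast
    show "future_timelike g T c (chart_inv c z) w"
      if "z \<in> ball (snd c x) r" "w \<in> ball (T c x) \<delta>" for z w
    proof -
      from that r AB have "(z, w) \<in> ?S" by blast
      then show ?thesis by (auto simp: F_def G_def future_timelike_def)
    qed
  qed
qed

text \<open>A straight line in the chart \<open>c\<close> has constant velocity \<open>w\<close>
  there, but a timelike curve is tested in every chart \<open>d\<close> of the atlas. In
  \<open>d\<close> the velocity is the image of \<open>w\<close> under the derivative of the
  transition map; it is continuous since that map is smooth, and future timelike since
  \<open>g\<close> and \<open>T\<close> transform by the same derivative.\<close>

lemma coordinate_segment_I_rel:
  assumes c: "c \<in> \<A>" and b: "b > 0"
    and seg: "\<And>t. t \<in> {0..b} \<Longrightarrow> x + t *\<^sub>R w \<in> snd c ` fst c"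
    and tl: "\<And>t. t \<in> {0..b} \<Longrightarrow> future_timelike g T c (chart_inv c (x + t *\<^sub>R w)) w"
  shows "(chart_inv c x, chart_inv c (x + b *\<^sub>R w)) \<in> I_rel \<A> g T"
proof -
  define l where "l = (\<lambda>t. x + t *\<^sub>R w)"
  define \<gamma> where "\<gamma> = chart_inv c \<circ> l"
  have cont_l: "continuous_on S l" for S
    unfolding l_def by (intro continuous_intros)
  have dl: "(l has_vector_derivative w) (at t within S)" for t S
    unfolding l_def by (auto intro!: derivative_eq_intros)
  have lc: "l t \<in> snd c ` fst c" if "t \<in> {0..b}" for t
    using seg[OF that] by (simp add: l_def)
  have \<gamma>c: "\<gamma> t \<in> fst c" "snd c (\<gamma> t) = l t" if "t \<in> {0..b}" for t
    using chart_inv_simps[OF c] lc[OF that] by (auto simp: \<gamma>_def)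
  have "timelike_C1_on \<A> g T 0 b \<gamma>"
    unfolding timelike_C1_on_def
  proof (intro conjI ballI)
    show "continuous_on {0..b} \<gamma>"
      unfolding \<gamma>_def using lc
      by (intro continuous_on_compose cont_l continuous_on_subset[OF continuous_on_chart_inv[OF c]])
        auto
    fix d assume d: "d \<in> \<A>"
    define S where "S = snd c ` (fst c \<inter> fst d)"
    have oS: "open S"
      unfolding S_def using chart(1) c d by (intro open_chart_image open_Int) auto
    have "C_k_on (Suc 0) S (transition c d)"
      using spacetime c d unfolding spacetime_def smooth_atlas_def smooth_on_def S_def by blast
    then have diff: "\<And>z. z \<in> S \<Longrightarrow> transition c d differentiable at z"
      and cd: "continuous_on S (\<lambda>z. frechet_derivative (transition c d) (at z) w)"
      by auto
    have lS: "l t \<in> S" if "t \<in> {0..b}" "\<gamma> t \<in> fst d" for t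
      using \<gamma>c[OF that(1)] that(2) unfolding S_def by (metis IntI image_eqI)
    show "\<exists>v. continuous_on {t\<in>{0..b}. \<gamma> t \<in> fst d} v \<and>
        (\<forall>t\<in>{0..b}. \<gamma> t \<in> fst d \<longrightarrow>
           ((snd d \<circ> \<gamma>) has_vector_derivative v t) (at t within {0..b}) \<and>
           future_timelike g T d (\<gamma> t) (v t))"
    proof (intro exI[of _ "\<lambda>t. frechet_derivative (transition c d) (at (l t)) w"]
        conjI ballI impI)
      show "continuous_on {t\<in>{0..b}. \<gamma> t \<in> fst d}
          (\<lambda>t. frechet_derivative (transition c d) (at (l t)) w)"
        by (rule continuous_on_compose2[OF cd cont_l]) (use lS in auto)
      fix t assume t: "t \<in> {0..b}" "\<gamma> t \<in> fst d"
      have "(transition c d has_derivative frechet_derivative (transition c d) (at (l t)))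
          (at (l t) within l ` {0..b})"
        using diff[OF lS[OF t]] by (meson frechet_derivative_works has_derivative_at_withinI)
      from vector_derivative_diff_chain_within[OF dl this]
      show "((snd d \<circ> \<gamma>) has_vector_derivative frechet_derivative (transition c d) (at (l t)) w)
          (at t within {0..b})"
        by (simp only: \<gamma>_def transition_def o_assoc)
      have D: "transition_deriv c d (\<gamma> t) = frechet_derivative (transition c d) (at (l t))"
        using \<gamma>c[OF t(1)] by (simp add: transition_deriv_def)
      have "future_timelike g T c (\<gamma> t) w"
        using tl[OF t(1)] by (simp add: \<gamma>_def l_def)
      moreover have "\<gamma> t \<in> fst c \<inter> fst d" using \<gamma>c[OF t(1)] t(2) by blast
      then have "g c (\<gamma> t) u v =
          g d (\<gamma> t) (transition_deriv c d (\<gamma> t) u) (transition_deriv c d (\<gamma> t) v)"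
        and "T d (\<gamma> t) = transition_deriv c d (\<gamma> t) (T c (\<gamma> t))" for u v
        using spacetime c d
        unfolding spacetime_def lorentzian_metric_def time_orientation_def by blast+
      ultimately show "future_timelike g T d (\<gamma> t)
          (frechet_derivative (transition c d) (at (l t)) w)"
        by (simp add: future_timelike_def D)
    qed
  qed
  then have "(\<gamma> 0, \<gamma> b) \<in> I_rel \<A> g T"
    using C1_rel_subset_I_rel b unfolding C1_rel_def by blast
  then show ?thesis by (simp add: \<gamma>_def l_def)
qed

text \<open>The sequence runs towards \<open>x\<close> along a coordinate line with direction
  \<open>T c x\<close>. Directions close to \<open>T c x\<close> are still future timelike, so
  straight lines from each of its points fill a neighbourhood of \<open>x\<close>.\<close>

lemma chronological_past_sequence:
  obtains y :: "nat \<Rightarrow> 'm" where "\<And>i. (y i, y (Suc i)) \<in> I_rel \<A> g T"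
    "\<And>i. x \<in> interior (I_rel \<A> g T `` {y i})" "y \<longlonglongrightarrow> x"
proof -
  obtain c where c: "c \<in> \<A>" "x \<in> fst c" by (rule chart_exists)
  then obtain r \<delta> where r: "r > 0" "\<delta> > 0" and sub: "ball (snd c x) r \<subseteq> snd c ` fst c"
    and tl: "\<And>z w. z \<in> ball (snd c x) r \<Longrightarrow> w \<in> ball (T c x) \<delta> \<Longrightarrow>
       future_timelike g T c (chart_inv c z) w"
    by (rule future_timelike_neighbourhood) blast
  have segment: "(chart_inv c z, chart_inv c (z + b *\<^sub>R w)) \<in> I_rel \<A> g T"
    if z: "z \<in> ball (snd c x) r" "z + b *\<^sub>R w \<in> ball (snd c x) r"
      and w: "w \<in> ball (T c x) \<delta>" and b: "b > 0" for z w b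
  proof -
    have "z + t *\<^sub>R w \<in> ball (snd c x) r" if t: "t \<in> {0..b}" for t
    proof -
      \<comment> \<open>Each point of the segment is a convex combination of its end points, so it
        stays in the ball.\<close>
      have "z + t *\<^sub>R w = (1 - t / b) *\<^sub>R z + (t / b) *\<^sub>R (z + b *\<^sub>R w)"
        using b by (simp add: algebra_simps)
      also have "\<dots> \<in> ball (snd c x) r"
        using z t b by (intro convexD convex_ball) auto
      finally show ?thesis .
    qed
    then show ?thesis
      using sub tl w by (intro coordinate_segment_I_rel c b) blast+
  qed
  define v where "v = T c x"
  \<comment> \<open>The choice gives \<open>\<epsilon> * norm v < r\<close>, which keeps every
    \<open>z i\<close> in the ball; the \<open>+ 1\<close> makes the denominator positive.\<close>
  define \<epsilon> where "\<epsilon> = r / (2 * (norm v + 1))"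
  define s where "s = (\<lambda>i. \<epsilon> / real (Suc i))"
  define z where "z = (\<lambda>i. snd c x - s i *\<^sub>R v)"
  have \<epsilon>: "\<epsilon> > 0" using r by (simp add: \<epsilon>_def add_nonneg_pos)
  have s: "s i > 0" "s (Suc i) < s i" "s i \<le> \<epsilon>" for i
    using \<epsilon> by (auto simp: s_def field_simps)
  have "\<epsilon> * norm v < r"
  proof -
    have "norm v < 2 * (norm v + 1)"
      using norm_ge_zero[of v] by argo
    then have "\<epsilon> * norm v < \<epsilon> * (2 * (norm v + 1))"
      using \<epsilon> by (rule mult_strict_left_mono)
    also have "\<dots> = r"
      using norm_ge_zero[of v] unfolding \<epsilon>_def by (simp add: add_nonneg_eq_0_iff)
    finally show ?thesis .
  qed
  moreover have "s i * norm v \<le> \<epsilon> * norm v" for i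
    using s by (simp add: mult_right_mono)
  ultimately have zr: "z i \<in> ball (snd c x) r" for i
    using s(1)[of i] by (auto simp: z_def dist_norm intro: le_less_trans)
  show thesis
  proof (rule that[of "\<lambda>i. chart_inv c (z i)"])
    fix i
    have "z (Suc i) = z i + (s i - s (Suc i)) *\<^sub>R v"
      by (simp add: z_def algebra_simps)
    then show "(chart_inv c (z i), chart_inv c (z (Suc i))) \<in> I_rel \<A> g T"
      using segment[of "z i" "s i - s (Suc i)" v] zr[of i] zr[of "Suc i"] s(2)[of i] r(2)
      by (simp add: v_def)
    \<comment> \<open>The bound \<open>r\<close> keeps the targets in the chart ball; the bound
      \<open>s i * \<delta>\<close> keeps the direction \<open>w\<close> below within
      \<open>\<delta>\<close> of \<open>v\<close>.\<close>
    define B where "B = ball (snd c x) (min r (s i * \<delta>))"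
    have "open (chart_inv c ` B)"
      using sub by (intro open_chart_inv_image c) (auto simp: B_def subset_iff)
    moreover have "x \<in> chart_inv c ` B"
      using chart_inv_simps(1)[OF c] r s(1)[of i] unfolding B_def
      by (metis centre_in_ball image_eqI min_less_iff_conj mult_pos_pos)
    moreover have "chart_inv c ` B \<subseteq> I_rel \<A> g T `` {chart_inv c (z i)}"
    proof clarify
      fix u assume u: "u \<in> B"
      \<comment> \<open>The constant velocity that leads from \<open>z i\<close> to \<open>u\<close>
        in parameter time \<open>s i\<close>.\<close>
      define w where "w = v + (u - snd c x) /\<^sub>R s i"
      have "u = z i + s i *\<^sub>R w"
        using s(1)[of i] by (simp add: w_def z_def algebra_simps)
      moreover have "norm (u - snd c x) < s i * \<delta>"
        using u by (simp add: B_def dist_norm norm_minus_commute)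
      then have "norm (u - snd c x) / s i < \<delta>"
        using s(1)[of i] by (simp add: pos_divide_less_eq mult.commute)
      then have "w \<in> ball (T c x) \<delta>"
        using s(1)[of i] by (simp add: w_def v_def dist_norm divide_inverse mult.commute)
      ultimately show "(chart_inv c (z i), chart_inv c u) \<in> I_rel \<A> g T"
        using segment[of "z i" "s i" w] zr[of i] s(1)[of i] u by (simp add: B_def)
    qed
    ultimately show "x \<in> interior (I_rel \<A> g T `` {chart_inv c (z i)})"
      by (meson interiorI)
  next
    have "s \<longlonglongrightarrow> 0"
      unfolding s_def using tendsto_mult[OF tendsto_const LIMSEQ_inverse_real_of_nat, of \<epsilon>]
      by (simp add: divide_inverse)
    then have "z \<longlonglongrightarrow> snd c x - 0 *\<^sub>R v"
      unfolding z_def by (intro tendsto_intros)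
    then have "(\<lambda>i. chart_inv c (z i)) \<longlonglongrightarrow> chart_inv c (snd c x)"
      using zr sub c
      by (intro continuous_on_tendsto_compose[OF continuous_on_chart_inv[OF c(1)]] always_eventually)
        (auto simp del: mem_ball)
    then show "(\<lambda>i. chart_inv c (z i)) \<longlonglongrightarrow> x"
      by (simp add: chart_inv_simps(1)[OF c])
  qed
qed

section \<open>The causal boundary\<close>

text \<open>The order intervals \<open>f i\<close> between \<open>y i\<close> and \<open>x\<close>
  are closed and nested, and each meets the compact frontier of \<open>N\<close>. A common point
  there is an upper bound of the sequence below \<open>x\<close> and different from
  \<open>x\<close>.\<close>

lemma interior_Int_causal_boundary:
  assumes K: "K_causal \<A> g T" and x: "x \<in> interior (K_plus \<A> g T p)"
  shows "x \<notin> causal_boundary \<A> g T p"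
proof
  let ?K = "K_rel \<A> g T"
  assume "x \<in> causal_boundary \<A> g T p"
  then obtain y where y: "\<And>i. (y i, y (Suc i)) \<in> ?K" "\<And>i. y i \<notin> K_plus \<A> g T p"
    and sup: "is_sup ?K (range y) x"
    unfolding causal_boundary_def by blast
  obtain N where N: "open N" "x \<in> N" "compact (closure N)" "closure N \<subseteq> interior (K_plus \<A> g T p)"
    using precompact_neighbourhood[OF open_interior x] by blast
  have yN: "y i \<notin> closure N" for i
    using N(4) y(2) interior_subset by blast
  have cf: "compact (frontier N)"
    using compact_Int_closed[OF N(3) frontier_closed[of N]]
    by (simp add: frontier_def Int_absorb1 Diff_subset)
  define f where "f = (\<lambda>i. {z. (y i, z) \<in> ?K} \<inter> {z. (z, x) \<in> ?K})"
  have "f (Suc i) \<subseteq> f i" for i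
    using y(1)[of i] transD[OF trans_K_rel] unfolding f_def by blast
  then have mono: "f j \<subseteq> f i" if "i \<le> j" for i j
    using that by (rule lift_Suc_antimono_le)
  have ne: "frontier N \<inter> f i \<noteq> {}" for i
    using K_rel_crosses_frontier[OF N(1) cf _ yN N(2)] sup by (auto simp: is_sup_def f_def)
  have "frontier N \<inter> (\<Inter>i. f i) \<noteq> {}"
  proof (rule compact_imp_fip_image[OF cf])
    show "closed (f i)" for i
      unfolding f_def by (intro closed_Int closed_K_rel_sections)
    fix J :: "nat set" assume "finite J"
    \<comment> \<open>By nestedness the set with the largest index lies in all the others; inserting
      \<open>0\<close> makes the maximum meaningful for empty \<open>J\<close>.\<close>
    then have "f (Max (insert 0 J)) \<subseteq> (\<Inter>i\<in>J. f i)"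
      using mono by (intro INT_greatest) (simp add: Max.coboundedI)
    then show "frontier N \<inter> (\<Inter>i\<in>J. f i) \<noteq> {}"
      using ne by blast
  qed
  then obtain z where z: "z \<in> frontier N" "\<And>i. (y i, z) \<in> ?K" "(z, x) \<in> ?K"
    by (auto simp: f_def)
  with sup have "(x, z) \<in> ?K" by (auto simp: is_sup_def)
  with z(3) K have "z = x" by (auto simp: K_causal_def dest: antisymD)
  with z(1) N(1,2) show False by (simp add: frontier_def interior_open)
qed

text \<open>If some \<open>y i\<close> were in \<open>K^+(p)\<close>, transitivity would put all of
  its chronological future there, and with it a neighbourhood of \<open>x\<close>.\<close>

lemma noninterior_in_causal_boundary:
  assumes "x \<in> K_plus \<A> g T p" "x \<notin> interior (K_plus \<A> g T p)"
  shows "x \<in> causal_boundary \<A> g T p"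
proof -
  let ?K = "K_rel \<A> g T"
  obtain y where y: "\<And>i. (y i, y (Suc i)) \<in> I_rel \<A> g T"
      "\<And>i. x \<in> interior (I_rel \<A> g T `` {y i})" and lim: "y \<longlonglongrightarrow> x"
    by (rule chronological_past_sequence[of x]) blast
  note IK = I_rel_subset_K_rel[of \<A> g T]
  have "y i \<notin> K_plus \<A> g T p" for i
  proof
    assume "y i \<in> K_plus \<A> g T p"
    then have "I_rel \<A> g T `` {y i} \<subseteq> K_plus \<A> g T p"
      using IK trans_K_rel by (fastforce simp: K_plus_def dest: transD)
    with y(2)[of i] interior_mono assms(2) show False by blast
  qed
  moreover have "is_sup ?K (range y) x"
    unfolding is_sup_def
  proof (intro conjI allI impI ballI)
    fix u assume "u \<in> range y"
    then show "(u, x) \<in> ?K" using y(2) interior_subset IK by fastforce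
  next
    fix z assume "\<forall>u\<in>range y. (u, z) \<in> ?K"
    \<comment> \<open>The points below \<open>z\<close> form a closed set containing every
      \<open>y i\<close>, hence also their limit \<open>x\<close>.\<close>
    then show "(x, z) \<in> ?K"
      using Lim_in_closed_set[OF closed_K_rel_sections(2)[of z \<A> g T] _ _ lim] by auto
  qed
  ultimately show ?thesis
    using assms(1) y(1) IK unfolding causal_boundary_def by blast
qed

end

theorem lemma3p4:
  fixes \<A> :: "('m::t2_space, 'e::euclidean_space) chart set"
    and g :: "('m, 'e) metric_field"
    and T :: "('m, 'e) vector_field"
  assumes "spacetime \<A> g T"
    and "K_causal \<A> g T"
  shows "\<forall>p. open (A_plus \<A> g T p) \<and> A_plus \<A> g T p = interior (K_plus \<A> g T p)"
proof
  fix p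
  interpret spacetime_context \<A> g T by standard (rule assms)
  have "A_plus \<A> g T p = interior (K_plus \<A> g T p)"
    using interior_Int_causal_boundary[OF assms(2), of _ p]
      noninterior_in_causal_boundary[of _ p] interior_subset
    unfolding A_plus_def by blast
  then show "open (A_plus \<A> g T p) \<and> A_plus \<A> g T p = interior (K_plus \<A> g T p)"
    by simp
qed

end
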